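(* Let $n\ge 1$, $m\ge 1$, and let $\psi:\mathbb{R}^n\to\mathbb{R}$ be a real-valued continuous negative definite function. Let $X_1,\dots,X_{2m}$ be i.i.d. random vectors in $\mathbb{R}^n$, and let $\varepsilon_1,\dots,\varepsilon_{2m}\in\{-1,+1\}$ be non-random, or random but such that $(\varepsilon_1,\dots,\varepsilon_{2m})$ is independent of $(X_1,\dots,X_{2m})$, satisfying $\sum_{j=1}^{2m}\varepsilon_j=0$. Then $$\mathbb{E}\,\psi\Bigl(\sum_{j=1}^{2m}\varepsilon_jX_j\Bigr)\le \mathbb{E}\,\psi\Bigl(\sum_{j=1}^{2m}X_j\Bigr).$$
   Context: A real-valued continuous negative definite function $\psi:\mathbb{R}^n\to\mathbb{R}$ is a function admitting the Lévy–Khintchine representation $$\psi(\xi)=a+\tfrac12\langle Q\xi,\xi\rangle+\int_{\mathbb{R}^n\setminus\{0\}}\bigl(1-\cos\langle\xi,u\rangle\bigr)\,\nu(du),\qquad \xi\in\mathbb{R}^n,$$ where $a\ge 0$ is a constant, $Q\in\mathbb{R}^{n\times n}$ is a symmetric positive semidefinite matrix and $\nu$ is a measure on $\mathbb{R}^n\setminus\{0\}$ with $\int_{\mathbb{R}^n\setminus\{0\}}\min\{\|u\|_2^2,1\}\,\nu(du)<\infty$. Here $\|\cdot\|_2$ is the Euclidean norm and $\langle\cdot,\cdot\rangle$ the Euclidean inner product. Such a $\psi$ is nonnegative, so the expectations are well defined in $[0,\infty]$ and the inequality is understood in $[0,\infty]$. *)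

theory Defs
  imports "HOL-Probability.Probability"
begin

definition symmetric_psd :: "real ^ 'n ^ 'n \<Rightarrow> bool" where
  "symmetric_psd Q \<longleftrightarrow> transpose Q = Q \<and> (\<forall>x. 0 \<le> (Q *v x) \<bullet> x)"

text \<open>
  The carrier of a Levy measure is the punctured space, so no integral below sees the origin.
\<close>

definition levy_measure :: "(real ^ 'n) measure \<Rightarrow> bool" where
  "levy_measure \<nu> \<longleftrightarrow>
     sets \<nu> = sets (restrict_space borel (UNIV - {0})) \<and>
     (\<integral>\<^sup>+u. ennreal (min ((norm u)\<^sup>2) 1) \<partial>\<nu>) < \<infinity>"

text \<open>
  The Bochner integral below never takes its default value: the integrand is dominated by
  a constant multiple of \<open>min (norm u ^ 2) 1\<close>.
\<close>

definition continuous_negative_definite :: "(real ^ 'n \<Rightarrow> real) \<Rightarrow> bool" where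
  "continuous_negative_definite \<psi> \<longleftrightarrow>
     (\<exists>a Q \<nu>. 0 \<le> a \<and> symmetric_psd Q \<and> levy_measure \<nu> \<and>
       (\<forall>\<xi>. \<psi> \<xi> = a + 1 / 2 * ((Q *v \<xi>) \<bullet> \<xi>) + (\<integral>u. (1 - cos (\<xi> \<bullet> u)) \<partial>\<nu>)))"

text \<open>
  The library constant \<^const>\<open>prob_space.indep_var\<close> forces both random variables to have
  the same value type; this is its unfolding for two value types.
\<close>

definition (in prob_space) indep_pair ::
    "'b measure \<Rightarrow> ('a \<Rightarrow> 'b) \<Rightarrow> 'c measure \<Rightarrow> ('a \<Rightarrow> 'c) \<Rightarrow> bool" where
  "indep_pair S Y T Z \<longleftrightarrow>
     random_variable S Y \<and> random_variable T Z \<and>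
     indep_set {Y -` A \<inter> space M | A. A \<in> sets S} {Z -` B \<inter> space M | B. B \<in> sets T}"

definition (in prob_space) iid :: "'b measure \<Rightarrow> ('i \<Rightarrow> 'a \<Rightarrow> 'b) \<Rightarrow> 'i set \<Rightarrow> bool" where
  "iid S X I \<longleftrightarrow>
     indep_vars (\<lambda>_. S) X I \<and> (\<forall>i\<in>I. \<forall>j\<in>I. distr M S (X i) = distr M S (X j))"

end

theory Submission
  imports Defs "HOL-Real_Asymp.Real_Asymp"
begin

text \<open>
  The inequality is a statement about characteristic functions. Let \<open>\<phi>\<close> be the common
  characteristic function of the \<open>X j\<close>, and fix signs that sum to zero. By independence the
  characteristic function of the signed sum at \<open>u\<close> is a product of equally many factors
  \<open>\<phi> u\<close> and \<open>cnj (\<phi> u)\<close>, hence it equals \<open>cmod (\<phi> u) ^ (2 * m)\<close>; that of the unsigned sum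
  is \<open>\<phi> u ^ (2 * m)\<close>, whose real part is at most as large. So the expected cosine along
  every direction \<open>u\<close> is at least as large for the signed sum
  (\<open>integral_cos_signed_sum_ge\<close>).

  A continuous negative definite function is increasing for this comparison of random vectors
  (\<open>nn_integral_continuous_negative_definite_mono\<close>), since apart from the
  constant each piece of its Levy-Khintchine representation is a mixture or a limit of functions
  \<open>1 - cos (\<xi> \<bullet> u)\<close>. For the jump part this is Tonelli's theorem. The quadratic part is a sum of
  squares \<open>(v \<bullet> \<xi>)\<^sup>2\<close>, and a square is the limit of
  \<open>2 * n\<^sup>2 * (1 - cos (v \<bullet> \<xi> / n))\<close> from below, so that Fatou's lemma transfers the
  comparison even when second moments are infinite.

  Random signs independent of the vectors are reduced to fixed ones by integrating the vectors
  out first (\<open>nn_integral_pair_indep\<close>).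
\<close>

section \<open>Positive semidefinite quadratic forms\<close>

lemma psd_Cauchy_Schwarz:
  assumes "symmetric_psd Q"
  shows "((Q *v x) \<bullet> y)\<^sup>2 \<le> ((Q *v x) \<bullet> x) * ((Q *v y) \<bullet> y)"
proof -
  define A B C where "A = (Q *v x) \<bullet> x" and "B = (Q *v x) \<bullet> y" and "C = (Q *v y) \<bullet> y"
  have sym: "(Q *v y) \<bullet> x = B"
    using assms unfolding symmetric_psd_def B_def
    by (metis dot_lmul_matrix inner_commute vector_transpose_matrix)
  have C0: "0 \<le> C" using assms unfolding symmetric_psd_def C_def by simp
  have *: "0 \<le> A + 2 * t * B + t\<^sup>2 * C" for t
  proof -
    have "0 \<le> (Q *v (x + t *\<^sub>R y)) \<bullet> (x + t *\<^sub>R y)"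
      using assms unfolding symmetric_psd_def by blast
    also have "\<dots> = A + 2 * t * B + t\<^sup>2 * C"
      unfolding A_def C_def using sym
      by (simp add: B_def matrix_vector_right_distrib matrix_vector_mult_scaleR inner_add_left
          inner_add_right power2_eq_square algebra_simps)
    finally show ?thesis .
  qed
  have "B\<^sup>2 \<le> A * C"
  proof (cases "C = 0")
    case True
    have "B = 0"
    proof (rule ccontr)
      assume "B \<noteq> 0"
      \<comment> \<open>The quadratic polynomial in \<open>t\<close> degenerates to an affine one, which takes the value \<open>-1\<close> here.\<close>
    then show False using *[of "- (A + 1) / (2 * B)"] True by (simp add: field_simps)
    qed
    with True show ?thesis by simp
  next
    case False
    then have "0 < C" using C0 by simp
    then show ?thesis using *[of "- B / C"]
      by (simp add: field_simps power2_eq_square)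
  qed
  then show ?thesis unfolding A_def B_def C_def .
qed

text \<open>
  Cholesky elimination: subtracting the square of the normalised \<open>k\<close>-th column clears the
  diagonal entry at \<open>k\<close> and keeps the form positive semidefinite by Cauchy-Schwarz. The set \<open>S\<close>
  collects the diagonal entries still to be cleared. If the pivot vanishes, so does its
  column, and since division by zero yields zero the elimination step changes nothing.
\<close>

lemma psd_sum_of_squares_on:
  fixes Q :: "real ^ 'n ^ 'n"
  assumes "finite S" "symmetric_psd Q" "\<And>i. i \<notin> S \<Longrightarrow> Q $ i $ i = 0"
  shows "\<exists>v. \<forall>x. (Q *v x) \<bullet> x = (\<Sum>i\<in>S. (v i \<bullet> x)\<^sup>2)"
  using assms
proof (induction S arbitrary: Q rule: finite_induct)
  case empty
  have "Q *v x = 0" for x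
  proof (subst vec_eq_iff, rule allI)
    have diag: "(Q *v axis i 1) \<bullet> axis i 1 = 0" for i
      using empty by (simp add: matrix_vector_mult_basis inner_axis column_def)
    show "(Q *v x) $ i = 0 $ i" for i
      using psd_Cauchy_Schwarz[OF empty(1), of x "axis i 1"] diag by (simp add: inner_axis)
  qed
  then show ?case by simp
next
  case (insert k S)
  define w where "w = Q *v axis k 1"
  define d where "d = Q $ k $ k"
  define Q' where "Q' = (\<chi> i j. Q $ i $ j - w $ i * w $ j / d)"
  have sym: "Q $ i $ j = Q $ j $ i" for i j
    using insert.prems(1) unfolding symmetric_psd_def transpose_def by (metis vec_lambda_beta)
  have w_nth: "w $ i = Q $ i $ k" for i
    by (simp add: w_def matrix_vector_mult_basis column_def)
  have d: "d = (Q *v axis k 1) \<bullet> axis k 1"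
    by (simp add: d_def matrix_vector_mult_basis inner_axis column_def)
  have d0: "0 \<le> d"
    using insert.prems(1) unfolding d symmetric_psd_def by blast
  have form: "(Q' *v x) \<bullet> x = (Q *v x) \<bullet> x - (w \<bullet> x)\<^sup>2 / d" for x
  proof -
    have "Q' *v x = Q *v x - ((w \<bullet> x) / d) *\<^sub>R w"
      by (simp add: vec_eq_iff Q'_def matrix_vector_mult_def inner_vec_def left_diff_distrib
          sum_subtractf sum_divide_distrib sum_distrib_left sum_distrib_right algebra_simps)
    then show ?thesis
      by (simp add: inner_diff_left power2_eq_square)
  qed
  have "0 \<le> (Q' *v x) \<bullet> x" for x
  proof -
    have "(w \<bullet> x)\<^sup>2 \<le> d * ((Q *v x) \<bullet> x)"
      using psd_Cauchy_Schwarz[OF insert.prems(1), of "axis k 1" x] by (simp add: w_def d)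
    moreover have "0 \<le> (Q *v x) \<bullet> x"
      using insert.prems(1) unfolding symmetric_psd_def by blast
    ultimately show ?thesis
      unfolding form using d0 by (cases "d = 0") (auto simp: field_simps)
  qed
  moreover have "transpose Q' = Q'"
    by (simp add: transpose_def Q'_def vec_eq_iff sym mult.commute)
  ultimately have psd: "symmetric_psd Q'"
    unfolding symmetric_psd_def by blast
  have "Q' $ i $ i = 0" if "i \<notin> S" for i
  proof (cases "i = k")
    case True
    then show ?thesis by (simp add: Q'_def w_nth d_def)
  next
    case False
    then have "Q $ i $ i = 0" using insert.prems(2) that by simp
    moreover have "0 \<le> (Q' *v axis i 1) \<bullet> axis i 1"
      using psd unfolding symmetric_psd_def by blast
    ultimately show ?thesis
      using d0
      by (auto simp: matrix_vector_mult_basis inner_axis column_def Q'_def divide_le_0_iff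
          not_sum_squares_lt_zero mult_le_0_iff)
  qed
  from insert.IH[OF psd this] obtain v
    where v: "\<And>x. (Q' *v x) \<bullet> x = (\<Sum>i\<in>S. (v i \<bullet> x)\<^sup>2)" by blast
  have "(Q *v x) \<bullet> x = (\<Sum>i\<in>insert k S. ((v(k := w /\<^sub>R sqrt d)) i \<bullet> x)\<^sup>2)" for x
  proof -
    have "(\<Sum>i\<in>insert k S. ((v(k := w /\<^sub>R sqrt d)) i \<bullet> x)\<^sup>2)
        = (w \<bullet> x)\<^sup>2 / d + (\<Sum>i\<in>S. (v i \<bullet> x)\<^sup>2)"
      using insert.hyps d0 
      by (auto simp: power_mult_distrib power_divide divide_inverse power_inverse intro!: sum.cong)
    then show ?thesis using form[of x] v[of x] by simp
  qed
  then show ?case by blast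
qed

section \<open>Comparing expected cosines\<close>

lemma one_minus_cos_le: "1 - cos x \<le> x\<^sup>2 / 2" for x :: real
proof -
  have "(sin (x / 2))\<^sup>2 \<le> (x / 2)\<^sup>2"
    using abs_sin_x_le_abs_x[of "x / 2"] by (simp only: abs_le_square_iff)
  then show ?thesis
    using cos_double_sin[of "x / 2"] by (simp add: power2_eq_square)
qed

lemma tendsto_scaled_one_minus_cos:
  "(\<lambda>n. 2 * (real n)\<^sup>2 * (1 - cos (x / real n))) \<longlonglongrightarrow> x\<^sup>2"
proof (cases "x = 0")
  case False
  then have "(\<lambda>n. 2 * (real n)\<^sup>2 * (1 - cos (x / real n))) \<longlonglongrightarrow> x * x" by real_asymp
  then show ?thesis by (simp add: power2_eq_square)
qed simp

lemma nn_integral_one_minus_cos_mono: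
  fixes f g :: "'a \<Rightarrow> real"
  assumes "prob_space M"
    and f[measurable]: "f \<in> borel_measurable M" and g[measurable]: "g \<in> borel_measurable M"
    and le: "(\<integral>\<omega>. cos (g \<omega>) \<partial>M) \<le> (\<integral>\<omega>. cos (f \<omega>) \<partial>M)"
  shows "(\<integral>\<^sup>+\<omega>. ennreal (1 - cos (f \<omega>)) \<partial>M) \<le> (\<integral>\<^sup>+\<omega>. ennreal (1 - cos (g \<omega>)) \<partial>M)"
proof -
  interpret prob_space M by fact
  have eq: "(\<integral>\<^sup>+\<omega>. ennreal (1 - cos (h \<omega>)) \<partial>M) = ennreal (1 - (\<integral>\<omega>. cos (h \<omega>) \<partial>M))"
    if [measurable]: "h \<in> borel_measurable M" for h :: "'a \<Rightarrow> real"
  proof -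
    have int: "integrable M (\<lambda>\<omega>. cos (h \<omega>))"
      by (rule integrable_const_bound[where B = 1]) auto
    then have "(\<integral>\<^sup>+\<omega>. ennreal (1 - cos (h \<omega>)) \<partial>M) = ennreal (\<integral>\<omega>. 1 - cos (h \<omega>) \<partial>M)"
      by (intro nn_integral_eq_integral) auto
    then show ?thesis using int by (simp add: prob_space)
  qed
  show ?thesis unfolding eq[OF f] eq[OF g] using le by (simp add: ennreal_leI)
qed

text \<open>
  Fatou's lemma bounds the left-hand side by the rescaled expectations of
  \<open>1 - cos (f / n)\<close>, the hypothesis replaces \<open>f\<close> by \<open>g\<close>, and on that side the rescaled functions
  stay below the square.
\<close>

lemma nn_integral_square_mono:
  fixes f g :: "'a \<Rightarrow> real"
  assumes "prob_space M"
    and f[measurable]: "f \<in> borel_measurable M" and g[measurable]: "g \<in> borel_measurable M"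
    and le: "\<And>t. (\<integral>\<omega>. cos (t * g \<omega>) \<partial>M) \<le> (\<integral>\<omega>. cos (t * f \<omega>) \<partial>M)"
  shows "(\<integral>\<^sup>+\<omega>. ennreal ((f \<omega>)\<^sup>2) \<partial>M) \<le> (\<integral>\<^sup>+\<omega>. ennreal ((g \<omega>)\<^sup>2) \<partial>M)"
proof -
  define s where "s n x = ennreal (2 * (real n)\<^sup>2 * (1 - cos (x / real n)))" for n x
  have s_eq: "s n x = ennreal (2 * (real n)\<^sup>2) * ennreal (1 - cos (inverse (real n) * x))" for n x
    by (simp add: s_def ennreal_mult divide_inverse mult.commute)
  have [measurable]: "(\<lambda>\<omega>. s n (f \<omega>)) \<in> borel_measurable M" for n
    unfolding s_def by measurable
  have "(\<lambda>n. s n x) \<longlonglongrightarrow> ennreal (x\<^sup>2)" for x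
    unfolding s_def by (intro tendsto_ennrealI tendsto_scaled_one_minus_cos)
  then have "(\<integral>\<^sup>+\<omega>. ennreal ((f \<omega>)\<^sup>2) \<partial>M) = (\<integral>\<^sup>+\<omega>. liminf (\<lambda>n. s n (f \<omega>)) \<partial>M)"
    by (intro nn_integral_cong lim_imp_Liminf[symmetric]) simp_all
  also have "\<dots> \<le> liminf (\<lambda>n. \<integral>\<^sup>+\<omega>. s n (f \<omega>) \<partial>M)"
    by (rule nn_integral_liminf) measurable
  also have "\<dots> \<le> (\<integral>\<^sup>+\<omega>. ennreal ((g \<omega>)\<^sup>2) \<partial>M)"
  proof (rule Liminf_le)
    have "(\<integral>\<^sup>+\<omega>. s n (f \<omega>) \<partial>M) \<le> (\<integral>\<^sup>+\<omega>. ennreal ((g \<omega>)\<^sup>2) \<partial>M)" for n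
    proof -
      have "(\<integral>\<^sup>+\<omega>. s n (f \<omega>) \<partial>M) \<le> (\<integral>\<^sup>+\<omega>. s n (g \<omega>) \<partial>M)"
        unfolding s_eq
        by (simp add: nn_integral_cmult)
          (intro mult_left_mono nn_integral_one_minus_cos_mono assms(1) le; measurable)
      also have "\<dots> \<le> (\<integral>\<^sup>+\<omega>. ennreal ((g \<omega>)\<^sup>2) \<partial>M)"
      proof (rule nn_integral_mono)
        fix \<omega>
        show "s n (g \<omega>) \<le> ennreal ((g \<omega>)\<^sup>2)"
        proof (cases "n = 0")
          case False
          then show ?thesis
            using mult_left_mono[OF one_minus_cos_le[of "g \<omega> / real n"], of "2 * (real n)\<^sup>2"]
            unfolding s_def by (intro ennreal_leI) (simp add: power_divide)
        qed (simp add: s_def)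
      qed
      finally show ?thesis .
    qed
    then show "\<forall>\<^sub>F n in sequentially. (\<integral>\<^sup>+\<omega>. s n (f \<omega>) \<partial>M) \<le> (\<integral>\<^sup>+\<omega>. ennreal ((g \<omega>)\<^sup>2) \<partial>M)"
      by simp
  qed simp
  finally show ?thesis .
qed

section \<open>Levy measures and negative definite functions\<close>

lemma levy_measure_id_measurable:
  assumes "levy_measure \<nu>" shows "(\<lambda>u. u) \<in> borel_measurable \<nu>"
proof -
  have "sets \<nu> = sets (restrict_space borel (UNIV - {0}))"
    using assms unfolding levy_measure_def by blast
  then show ?thesis
    by (simp add: measurable_restrict_space1 cong: measurable_cong_sets)
qed

text \<open>
  The integrable function \<open>min ((norm u)\<^sup>2) 1\<close> has no zero away from the origin, so
  Markov's inequality makes its superlevel sets an exhaustion by sets of finite measure.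
\<close>

lemma levy_measure_sigma_finite:
  assumes "levy_measure \<nu>" shows "sigma_finite_measure \<nu>"
proof
  note [measurable] = levy_measure_id_measurable[OF assms]
  have sets: "sets \<nu> = sets (restrict_space borel (UNIV - {0}))"
    and fin: "(\<integral>\<^sup>+u. ennreal (min ((norm u)\<^sup>2) 1) \<partial>\<nu>) < \<infinity>"
    using assms unfolding levy_measure_def by auto
  have space: "space \<nu> = UNIV - {0}"
    using sets_eq_imp_space_eq[OF sets] by (simp add: space_restrict_space)
  define A where "A n = {u \<in> space \<nu>. 1 \<le> of_nat n * ennreal (min ((norm u)\<^sup>2) 1)}" for n
  have A[measurable]: "A n \<in> sets \<nu>" for n unfolding A_def by measurable
  have "emeasure \<nu> (A n) < \<infinity>" for n
  proof -
    have "emeasure \<nu> (A n) \<le> of_nat n * (\<integral>\<^sup>+u. ennreal (min ((norm u)\<^sup>2) 1) * indicator (space \<nu>) u \<partial>\<nu>)"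
      using nn_integral_Markov_inequality[of "\<lambda>u. ennreal (min ((norm u)\<^sup>2) 1)" "space \<nu>" \<nu> "of_nat n"]
      unfolding A_def by simp
    also have "\<dots> = of_nat n * (\<integral>\<^sup>+u. ennreal (min ((norm u)\<^sup>2) 1) \<partial>\<nu>)"
      by (intro arg_cong2[where f = "(*)"] refl nn_integral_cong) simp
    also have "\<dots> < \<infinity>" using fin by (simp add: ennreal_mult_less_top of_nat_less_top)
    finally show ?thesis .
  qed
  moreover have "u \<in> (\<Union>n. A n)" if "u \<in> space \<nu>" for u
  proof -
    define r where "r = min ((norm u)\<^sup>2) 1"
    have "0 < r" using that space by (simp add: r_def)
    then obtain n :: nat where "1 < real n * r"
      using reals_Archimedean3 by blast
    then have "ennreal 1 \<le> ennreal (real n * r)" by (intro ennreal_leI) simp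
    then have "1 \<le> of_nat n * ennreal r" using \<open>0 < r\<close>
      by (simp add: ennreal_mult ennreal_of_nat_eq_real_of_nat)
    then show ?thesis using that by (auto simp: A_def r_def)
  qed
  moreover have "A n \<subseteq> space \<nu>" for n unfolding A_def by blast
  ultimately show "\<exists>\<A>. countable \<A> \<and> \<A> \<subseteq> sets \<nu> \<and> \<Union> \<A> = space \<nu> \<and> (\<forall>a\<in>\<A>. emeasure \<nu> a \<noteq> \<infinity>)"
    using A by (intro exI[of _ "range A"]) (auto simp: less_top[symmetric])
qed

lemma levy_measure_integrable_one_minus_cos:
  assumes "levy_measure \<nu>" shows "integrable \<nu> (\<lambda>u. 1 - cos (\<xi> \<bullet> u))"
proof -
  note [measurable] = levy_measure_id_measurable[OF assms]
  have fin: "(\<integral>\<^sup>+u. ennreal (min ((norm u)\<^sup>2) 1) \<partial>\<nu>) < \<infinity>"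
    using assms unfolding levy_measure_def by auto
  define C where "C = max 2 ((norm \<xi>)\<^sup>2)"
  have bound: "1 - cos (\<xi> \<bullet> u) \<le> C * min ((norm u)\<^sup>2) 1" for u
  proof -
    have "1 - cos (\<xi> \<bullet> u) \<le> (\<xi> \<bullet> u)\<^sup>2 / 2" by (rule one_minus_cos_le)
    also have "\<dots> \<le> (\<xi> \<bullet> u)\<^sup>2" by simp
    also have "\<dots> \<le> (norm \<xi> * norm u)\<^sup>2"
      using Cauchy_Schwarz_ineq2[of \<xi> u] by (simp add: abs_le_square_iff[symmetric])
    also have "\<dots> \<le> C * (norm u)\<^sup>2"
      unfolding power_mult_distrib C_def by (intro mult_right_mono) auto
    finally have "1 - cos (\<xi> \<bullet> u) \<le> C * (norm u)\<^sup>2" .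
    moreover have "1 - cos (\<xi> \<bullet> u) \<le> C"
    proof -
      have "1 - cos (\<xi> \<bullet> u) \<le> 2" using cos_ge_minus_one[of "\<xi> \<bullet> u"] by linarith
      moreover have "2 \<le> C" unfolding C_def by simp
      ultimately show ?thesis by linarith
    qed
    ultimately show ?thesis by (simp add: min_def)
  qed
  have "integrable \<nu> (\<lambda>u. min ((norm u)\<^sup>2) 1)"
    using fin by (intro integrableI_nonneg) auto
  then have "integrable \<nu> (\<lambda>u. C * min ((norm u)\<^sup>2) 1)" by simp
  then show ?thesis
    by (rule Bochner_Integration.integrable_bound) (use bound in \<open>auto intro: order_trans[OF _ abs_ge_self]\<close>)
qed

text \<open>
  All three pieces of the representation are nonnegative, so it can be read in \<open>[0, \<infinity>]\<close>,
  where sums and integrals may be interchanged freely.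
\<close>

lemma continuous_negative_definite_ennreal:
  fixes \<psi> :: "real ^ 'n \<Rightarrow> real"
  assumes "continuous_negative_definite \<psi>"
  obtains a :: real and v :: "'n \<Rightarrow> real ^ 'n" and \<nu> where "levy_measure \<nu>"
    "\<And>\<xi>. ennreal (\<psi> \<xi>) = ennreal a + (\<Sum>i\<in>UNIV. ennreal (1 / 2) * ennreal ((v i \<bullet> \<xi>)\<^sup>2))
        + (\<integral>\<^sup>+u. ennreal (1 - cos (\<xi> \<bullet> u)) \<partial>\<nu>)"
proof -
  obtain a Q \<nu> where a: "0 \<le> a" and Q: "symmetric_psd Q" and \<nu>: "levy_measure \<nu>"
    and \<psi>: "\<And>\<xi>. \<psi> \<xi> = a + 1 / 2 * ((Q *v \<xi>) \<bullet> \<xi>) + (\<integral>u. (1 - cos (\<xi> \<bullet> u)) \<partial>\<nu>)"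
    using assms unfolding continuous_negative_definite_def by blast
  have "\<exists>v. \<forall>x. (Q *v x) \<bullet> x = (\<Sum>i\<in>(UNIV :: 'n set). (v i \<bullet> x)\<^sup>2)"
    by (rule psd_sum_of_squares_on[OF finite Q]) simp
  then obtain v where v: "\<And>x. (Q *v x) \<bullet> x = (\<Sum>i\<in>(UNIV :: 'n set). (v i \<bullet> x)\<^sup>2)"
    by blast
  have "ennreal (\<psi> \<xi>) = ennreal a + (\<Sum>i\<in>UNIV. ennreal (1 / 2) * ennreal ((v i \<bullet> \<xi>)\<^sup>2))
        + (\<integral>\<^sup>+u. ennreal (1 - cos (\<xi> \<bullet> u)) \<partial>\<nu>)" for \<xi>
  proof -
    have "(\<integral>\<^sup>+u. ennreal (1 - cos (\<xi> \<bullet> u)) \<partial>\<nu>) = ennreal (\<integral>u. (1 - cos (\<xi> \<bullet> u)) \<partial>\<nu>)"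
      by (intro nn_integral_eq_integral levy_measure_integrable_one_minus_cos \<nu>) simp
    moreover have "0 \<le> (\<integral>u. (1 - cos (\<xi> \<bullet> u)) \<partial>\<nu>)" by simp
    moreover have "(\<Sum>i\<in>UNIV. ennreal (1 / 2) * ennreal ((v i \<bullet> \<xi>)\<^sup>2))
        = ennreal (1 / 2 * (\<Sum>i\<in>UNIV. (v i \<bullet> \<xi>)\<^sup>2))"
    proof -
      have "(\<Sum>i\<in>UNIV. ennreal (1 / 2) * ennreal ((v i \<bullet> \<xi>)\<^sup>2))
          = (\<Sum>i\<in>UNIV. ennreal (1 / 2 * (v i \<bullet> \<xi>)\<^sup>2))"
        by (intro sum.cong refl ennreal_mult[symmetric]) auto
      also have "\<dots> = ennreal (\<Sum>i\<in>UNIV. 1 / 2 * (v i \<bullet> \<xi>)\<^sup>2)"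
        by (rule sum_ennreal) simp
      finally show ?thesis by (simp only: sum_distrib_left)
    qed
    ultimately show ?thesis unfolding \<psi> v using a by (simp add: sum_nonneg)
  qed
  with \<nu> show ?thesis by (rule that)
qed

lemma continuous_negative_definite_measurable:
  fixes \<psi> :: "real ^ 'n \<Rightarrow> real"
  assumes "continuous_negative_definite \<psi>"
  shows "\<psi> \<in> borel_measurable borel"
proof -
  obtain a Q \<nu> where \<nu>: "levy_measure \<nu>"
    and repr: "\<And>\<xi>. \<psi> \<xi> = a + 1 / 2 * ((Q *v \<xi>) \<bullet> \<xi>) + (\<integral>u. (1 - cos (\<xi> \<bullet> u)) \<partial>\<nu>)"
    using assms unfolding continuous_negative_definite_def by blast
  have \<psi>: "\<psi> = (\<lambda>\<xi>. a + 1 / 2 * ((Q *v \<xi>) \<bullet> \<xi>) + (\<integral>u. (1 - cos (\<xi> \<bullet> u)) \<partial>\<nu>))"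
    by (rule ext) (rule repr)
  interpret sigma_finite_measure \<nu> by (rule levy_measure_sigma_finite[OF \<nu>])
  note [measurable] = measurable_compose[OF measurable_snd levy_measure_id_measurable[OF \<nu>]]
  have [measurable]: "(\<lambda>\<xi>. Q *v \<xi>) \<in> borel_measurable borel"
    by (intro borel_measurable_continuous_onI continuous_intros)
  show ?thesis unfolding \<psi> by measurable
qed

lemma nn_integral_continuous_negative_definite_mono:
  fixes \<psi> :: "real ^ 'n \<Rightarrow> real" and Y Z :: "'a \<Rightarrow> real ^ 'n"
  assumes M: "prob_space M" and \<psi>: "continuous_negative_definite \<psi>"
    and Y: "Y \<in> borel_measurable M" and Z: "Z \<in> borel_measurable M"
    and le: "\<And>u. (\<integral>\<omega>. cos (Z \<omega> \<bullet> u) \<partial>M) \<le> (\<integral>\<omega>. cos (Y \<omega> \<bullet> u) \<partial>M)"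
  shows "(\<integral>\<^sup>+\<omega>. ennreal (\<psi> (Y \<omega>)) \<partial>M) \<le> (\<integral>\<^sup>+\<omega>. ennreal (\<psi> (Z \<omega>)) \<partial>M)"
proof -
  interpret prob_space M by fact
  obtain a :: real and v :: "'n \<Rightarrow> real ^ 'n" and \<nu> where \<nu>: "levy_measure \<nu>"
    and repr: "\<And>\<xi>. ennreal (\<psi> \<xi>) = ennreal a
        + (\<Sum>i\<in>UNIV. ennreal (1 / 2) * ennreal ((v i \<bullet> \<xi>)\<^sup>2))
        + (\<integral>\<^sup>+u. ennreal (1 - cos (\<xi> \<bullet> u)) \<partial>\<nu>)"
    by (rule continuous_negative_definite_ennreal[OF \<psi>]) (rule that)
  interpret N: sigma_finite_measure \<nu> by (rule levy_measure_sigma_finite[OF \<nu>])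
  interpret pair_sigma_finite M \<nu> ..
  note [measurable] = measurable_compose[OF measurable_snd levy_measure_id_measurable[OF \<nu>]]
  have expand: "(\<integral>\<^sup>+\<omega>. ennreal (\<psi> (W \<omega>)) \<partial>M) = ennreal a
      + (\<Sum>i\<in>UNIV. ennreal (1 / 2) * (\<integral>\<^sup>+\<omega>. ennreal ((v i \<bullet> W \<omega>)\<^sup>2) \<partial>M))
      + (\<integral>\<^sup>+u. \<integral>\<^sup>+\<omega>. ennreal (1 - cos (W \<omega> \<bullet> u)) \<partial>M \<partial>\<nu>)"
    if [measurable]: "W \<in> borel_measurable M" for W
  proof -
    have meas: "(\<lambda>(\<omega>, u). ennreal (1 - cos (W \<omega> \<bullet> u))) \<in> borel_measurable (M \<Otimes>\<^sub>M \<nu>)"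
      unfolding split_beta' by measurable
    note [measurable] = N.borel_measurable_nn_integral[OF meas]
    have "(\<integral>\<^sup>+\<omega>. ennreal (\<psi> (W \<omega>)) \<partial>M)
        = (\<integral>\<^sup>+\<omega>. ennreal a \<partial>M)
          + (\<integral>\<^sup>+\<omega>. (\<Sum>i\<in>UNIV. ennreal (1 / 2) * ennreal ((v i \<bullet> W \<omega>)\<^sup>2)) \<partial>M)
          + (\<integral>\<^sup>+\<omega>. \<integral>\<^sup>+u. ennreal (1 - cos (W \<omega> \<bullet> u)) \<partial>\<nu> \<partial>M)"
      unfolding repr by (subst nn_integral_add; (subst nn_integral_add)?; measurable)
    also have "(\<integral>\<^sup>+\<omega>. ennreal a \<partial>M) = ennreal a"
      by (simp add: emeasure_space_1)
    also have "(\<integral>\<^sup>+\<omega>. (\<Sum>i\<in>UNIV. ennreal (1 / 2) * ennreal ((v i \<bullet> W \<omega>)\<^sup>2)) \<partial>M)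
        = (\<Sum>i\<in>UNIV. ennreal (1 / 2) * (\<integral>\<^sup>+\<omega>. ennreal ((v i \<bullet> W \<omega>)\<^sup>2) \<partial>M))"
      by (subst nn_integral_sum) (auto intro!: sum.cong nn_integral_cmult)
    also note Fubini'[OF meas, symmetric]
    finally show ?thesis .
  qed
  have square: "(\<integral>\<^sup>+\<omega>. ennreal ((w \<bullet> Y \<omega>)\<^sup>2) \<partial>M) \<le> (\<integral>\<^sup>+\<omega>. ennreal ((w \<bullet> Z \<omega>)\<^sup>2) \<partial>M)" for w
    using Y Z le[of "t *\<^sub>R w" for t]
    by (intro nn_integral_square_mono M) (auto simp: inner_commute)
  have jump: "(\<integral>\<^sup>+\<omega>. ennreal (1 - cos (Y \<omega> \<bullet> u)) \<partial>M) \<le> (\<integral>\<^sup>+\<omega>. ennreal (1 - cos (Z \<omega> \<bullet> u)) \<partial>M)" for u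
    using Y Z by (intro nn_integral_one_minus_cos_mono M le) auto
  show ?thesis
    unfolding expand[OF Y] expand[OF Z]
    by (intro add_mono order_refl sum_mono mult_left_mono square nn_integral_mono jump) simp
qed

section \<open>Signed sums of independent identically distributed vectors\<close>

lemma cis_sum: "cis (\<Sum>j\<in>J. f j) = (\<Prod>j\<in>J. cis (f j))"
  by (induction J rule: infinite_finite_induct) (simp_all flip: cis_mult)

text \<open>
  Reversing the sign of a summand conjugates its factor in the characteristic function of the
  sum. With as many negative as positive signs the factors pair up to squared moduli.
\<close>

lemma integral_cos_signed_sum_ge:
  fixes X :: "'i \<Rightarrow> 'a \<Rightarrow> 'b :: euclidean_space"
  assumes M: "prob_space M" and iid: "prob_space.iid M borel X J" and J: "finite J"
    and c: "\<And>j. j \<in> J \<Longrightarrow> c j \<in> {-1, 1 :: real}" and sum_c: "(\<Sum>j\<in>J. c j) = 0"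
  shows "(\<integral>\<omega>. cos ((\<Sum>j\<in>J. X j \<omega>) \<bullet> u) \<partial>M) \<le> (\<integral>\<omega>. cos ((\<Sum>j\<in>J. c j *\<^sub>R X j \<omega>) \<bullet> u) \<partial>M)"
proof -
  interpret prob_space M by fact
  have ind: "indep_vars (\<lambda>_. borel) X J"
    and ident: "\<And>i j. i \<in> J \<Longrightarrow> j \<in> J \<Longrightarrow> distr M borel (X i) = distr M borel (X j)"
    using iid unfolding iid_def by blast+
  have rv: "X j \<in> borel_measurable M" if "j \<in> J" for j
    using ind that unfolding indep_vars_def by blast
  have "cis \<in> borel_measurable borel"
    by (intro borel_measurable_continuous_onI continuous_intros)
  note [measurable (raw)] = measurable_compose[OF _ this]
  have int: "integrable M (\<lambda>\<omega>. cis (h \<omega>))" if [measurable]: "h \<in> borel_measurable M" for h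
    by (rule integrable_const_bound[where B = 1]) auto
  \<comment> \<open>The common characteristic function at \<open>u\<close>; an arbitrary index serves as representative.\<close>
  define z where "z = (\<integral>\<omega>. cis (X (SOME j. j \<in> J) \<omega> \<bullet> u) \<partial>M)"
  have z: "(\<integral>\<omega>. cis (X j \<omega> \<bullet> u) \<partial>M) = z" if "j \<in> J" for j
  proof -
    have law: "(\<integral>\<omega>. cis (X i \<omega> \<bullet> u) \<partial>M) = (\<integral>x. cis (x \<bullet> u) \<partial>distr M borel (X i))" if "i \<in> J" for i
      using rv[OF that]
      by (intro integral_distr[symmetric] borel_measurable_continuous_onI continuous_intros)
    have "(SOME j. j \<in> J) \<in> J" using that by (rule someI)
    then show ?thesis unfolding z_def using law ident that by metis
  qed
  have expect: "(\<integral>\<omega>. cos ((\<Sum>j\<in>J. d j *\<^sub>R X j \<omega>) \<bullet> u) \<partial>M)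
      = Re (\<Prod>j\<in>J. if d j = 1 then z else cnj z)" if d: "\<And>j. j \<in> J \<Longrightarrow> d j \<in> {-1, 1 :: real}" for d
  proof -
    have "(\<integral>\<omega>. cos ((\<Sum>j\<in>J. d j *\<^sub>R X j \<omega>) \<bullet> u) \<partial>M)
        = (\<integral>\<omega>. Re (cis ((\<Sum>j\<in>J. d j *\<^sub>R X j \<omega>) \<bullet> u)) \<partial>M)" by simp
    also have "\<dots> = Re (\<integral>\<omega>. cis ((\<Sum>j\<in>J. d j *\<^sub>R X j \<omega>) \<bullet> u) \<partial>M)"
      by (intro integral_bounded_linear bounded_linear_Re int) (use rv in auto)
    also have "(\<integral>\<omega>. cis ((\<Sum>j\<in>J. d j *\<^sub>R X j \<omega>) \<bullet> u) \<partial>M)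
        = (\<integral>\<omega>. (\<Prod>j\<in>J. cis (d j * (X j \<omega> \<bullet> u))) \<partial>M)"
      by (simp add: inner_sum_left cis_sum)
    also have "\<dots> = (\<Prod>j\<in>J. \<integral>\<omega>. cis (d j * (X j \<omega> \<bullet> u)) \<partial>M)"
    proof (rule indep_vars_lebesgue_integral[OF J])
      show "indep_vars (\<lambda>_. borel) (\<lambda>j \<omega>. cis (d j * (X j \<omega> \<bullet> u))) J"
        by (rule indep_vars_compose2[OF ind, where Y = "\<lambda>j x. cis (d j * (x \<bullet> u))"]) auto
      show "integrable M (\<lambda>\<omega>. cis (d j * (X j \<omega> \<bullet> u)))" if "j \<in> J" for j
        using rv[OF that] by (intro int) auto
    qed
    also have "\<dots> = (\<Prod>j\<in>J. if d j = 1 then z else cnj z)"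
    proof (rule prod.cong[OF refl])
      fix j assume j: "j \<in> J"
      show "(\<integral>\<omega>. cis (d j * (X j \<omega> \<bullet> u)) \<partial>M) = (if d j = 1 then z else cnj z)"
      proof (cases "d j = 1")
        case False
        then have "d j = -1" using d[OF j] by auto
        then have "(\<integral>\<omega>. cis (d j * (X j \<omega> \<bullet> u)) \<partial>M) = (\<integral>\<omega>. cnj (cis (X j \<omega> \<bullet> u)) \<partial>M)"
          by (simp add: cis_cnj)
        then show ?thesis using False z[OF j] by (simp only: Bochner_Integration.integral_cnj if_False)
      qed (simp add: z[OF j])
    qed
    finally show ?thesis .
  qed
  define P N where "P = {j \<in> J. c j = 1}" and "N = {j \<in> J. c j \<noteq> 1}"
  have PN: "J = P \<union> N" "P \<inter> N = {}" "finite P" "finite N"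
    using J unfolding P_def N_def by auto
  have "(\<Sum>j\<in>J. c j) = (\<Sum>j\<in>P. c j) + (\<Sum>j\<in>N. c j)"
    unfolding PN(1) using PN by (intro sum.union_disjoint)
  also have "(\<Sum>j\<in>P. c j) = (\<Sum>j\<in>P. 1)"
    by (rule sum.cong) (auto simp: P_def)
  also have "(\<Sum>j\<in>N. c j) = (\<Sum>j\<in>N. - 1)"
    by (rule sum.cong) (use c in \<open>auto simp: N_def\<close>)
  finally have card: "card N = card P" using sum_c by simp
  have "(\<Prod>j\<in>J. if c j = 1 then z else cnj z)
      = (\<Prod>j\<in>P. if c j = 1 then z else cnj z) * (\<Prod>j\<in>N. if c j = 1 then z else cnj z)"
    unfolding PN(1) using PN by (intro prod.union_disjoint)
  also have "(\<Prod>j\<in>P. if c j = 1 then z else cnj z) = (\<Prod>j\<in>P. z)"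
    by (rule prod.cong) (auto simp: P_def)
  also have "(\<Prod>j\<in>N. if c j = 1 then z else cnj z) = (\<Prod>j\<in>N. cnj z)"
    by (rule prod.cong) (auto simp: N_def)
  also have "(\<Prod>j\<in>P. z) * (\<Prod>j\<in>N. cnj z) = of_real ((cmod z) ^ (2 * card P))"
    by (simp add: card power_mult flip: power_mult_distrib complex_norm_square)
  finally have signed: "(\<integral>\<omega>. cos ((\<Sum>j\<in>J. c j *\<^sub>R X j \<omega>) \<bullet> u) \<partial>M) = (cmod z) ^ (2 * card P)"
    using expect[of c] c by simp
  have "card J = 2 * card P" using PN card by (simp add: card_Un_disjoint)
  then have "(\<integral>\<omega>. cos ((\<Sum>j\<in>J. X j \<omega>) \<bullet> u) \<partial>M) = Re (z ^ (2 * card P))"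
    using expect[of "\<lambda>_. 1"] by simp
  also have "\<dots> \<le> cmod (z ^ (2 * card P))" by (rule complex_Re_le_cmod)
  finally show ?thesis unfolding signed by (simp add: norm_power)
qed

lemma nn_integral_signed_sum_le:
  fixes \<psi> :: "real ^ 'n \<Rightarrow> real" and X :: "'i \<Rightarrow> 'a \<Rightarrow> real ^ 'n"
  assumes M: "prob_space M" and \<psi>: "continuous_negative_definite \<psi>"
    and iid: "prob_space.iid M borel X J" and J: "finite J"
    and c: "\<And>j. j \<in> J \<Longrightarrow> c j \<in> {-1, 1 :: real}" and sum_c: "(\<Sum>j\<in>J. c j) = 0"
  shows "(\<integral>\<^sup>+\<omega>. ennreal (\<psi> (\<Sum>j\<in>J. c j *\<^sub>R X j \<omega>)) \<partial>M)
       \<le> (\<integral>\<^sup>+\<omega>. ennreal (\<psi> (\<Sum>j\<in>J. X j \<omega>)) \<partial>M)"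
proof (rule nn_integral_continuous_negative_definite_mono[OF M \<psi>])
  interpret prob_space M by fact
  have "X j \<in> borel_measurable M" if "j \<in> J" for j
    using iid that unfolding iid_def indep_vars_def by blast
  then show "(\<lambda>\<omega>. \<Sum>j\<in>J. c j *\<^sub>R X j \<omega>) \<in> borel_measurable M"
    "(\<lambda>\<omega>. \<Sum>j\<in>J. X j \<omega>) \<in> borel_measurable M" by measurable
qed (rule integral_cos_signed_sum_ge[OF M iid J c sum_c])

section \<open>Random signs\<close>

text \<open>
  The joint law of an independent pair is the product of the two laws, so the second component
  can be integrated out over its own copy of the probability space.
\<close>

lemma nn_integral_pair_indep:
  assumes "prob_space M" "prob_space.indep_pair M S Y T Z"
    and f: "f \<in> borel_measurable (S \<Otimes>\<^sub>M T)"
  shows "(\<integral>\<^sup>+\<omega>. f (Y \<omega>, Z \<omega>) \<partial>M) = (\<integral>\<^sup>+\<omega>. (\<integral>\<^sup>+\<omega>'. f (Y \<omega>, Z \<omega>') \<partial>M) \<partial>M)"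
proof -
  interpret prob_space M by fact
  have Y[measurable]: "Y \<in> measurable M S" and Z[measurable]: "Z \<in> measurable M T"
    and ind: "indep_set {Y -` A \<inter> space M | A. A \<in> sets S} {Z -` B \<inter> space M | B. B \<in> sets T}"
    using assms(2) unfolding indep_pair_def by auto
  interpret D: prob_space "distr M S Y" by (rule prob_space_distr) (rule Y)
  interpret E: prob_space "distr M T Z" by (rule prob_space_distr) (rule Z)
  interpret pair_sigma_finite "distr M S Y" "distr M T Z" ..
  have "distr M S Y \<Otimes>\<^sub>M distr M T Z = distr M (S \<Otimes>\<^sub>M T) (\<lambda>\<omega>. (Y \<omega>, Z \<omega>))"
  proof (rule pair_measure_eqI)
    show "sigma_finite_measure (distr M S Y)" "sigma_finite_measure (distr M T Z)"
      by unfold_locales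
    show "sets (distr M S Y \<Otimes>\<^sub>M distr M T Z) = sets (distr M (S \<Otimes>\<^sub>M T) (\<lambda>\<omega>. (Y \<omega>, Z \<omega>)))"
      by (simp cong: sets_pair_measure_cong)
  next
    fix A B assume "A \<in> sets (distr M S Y)" "B \<in> sets (distr M T Z)"
    then have A[measurable]: "A \<in> sets S" and B[measurable]: "B \<in> sets T" by auto
    have "(\<lambda>\<omega>. (Y \<omega>, Z \<omega>)) -` (A \<times> B) \<inter> space M = (Y -` A \<inter> space M) \<inter> (Z -` B \<inter> space M)"
      by auto
    moreover have "prob ((Y -` A \<inter> space M) \<inter> (Z -` B \<inter> space M))
        = prob (Y -` A \<inter> space M) * prob (Z -` B \<inter> space M)"
      by (rule indep_setD[OF ind]) (use A B in auto)
    ultimately show "emeasure (distr M S Y) A * emeasure (distr M T Z) B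
        = emeasure (distr M (S \<Otimes>\<^sub>M T) (\<lambda>\<omega>. (Y \<omega>, Z \<omega>))) (A \<times> B)"
      by (simp add: emeasure_distr emeasure_eq_measure ennreal_mult'')
  qed
  then have "(\<integral>\<^sup>+\<omega>. f (Y \<omega>, Z \<omega>) \<partial>M) = (\<integral>\<^sup>+z. f z \<partial>(distr M S Y \<Otimes>\<^sub>M distr M T Z))"
    using f by (simp add: nn_integral_distr)
  also have "\<dots> = (\<integral>\<^sup>+y. \<integral>\<^sup>+z. f (y, z) \<partial>distr M T Z \<partial>distr M S Y)"
    using f by (intro E.nn_integral_fst[symmetric]) (simp cong: measurable_cong_sets sets_pair_measure_cong)
  also have "\<dots> = (\<integral>\<^sup>+y. \<integral>\<^sup>+\<omega>'. f (y, Z \<omega>') \<partial>M \<partial>distr M S Y)"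
    using f by (intro nn_integral_cong nn_integral_distr) auto
  also have "\<dots> = (\<integral>\<^sup>+\<omega>. (\<integral>\<^sup>+\<omega>'. f (Y \<omega>, Z \<omega>') \<partial>M) \<partial>M)"
    using f by (intro nn_integral_distr) auto
  finally show ?thesis .
qed

theorem mainTheorem2:
  fixes M :: "'a measure"
    and \<psi> :: "real ^ 'n \<Rightarrow> real"
    and X :: "nat \<Rightarrow> 'a \<Rightarrow> real ^ 'n"
    and \<epsilon> :: "nat \<Rightarrow> 'a \<Rightarrow> real"
    and m :: nat
  assumes "prob_space M"
    and "1 \<le> m"
    and "continuous_negative_definite \<psi>"
    and "prob_space.iid M borel X {1..2 * m}"
    and "\<And>j \<omega>. j \<in> {1..2 * m} \<Longrightarrow> \<omega> \<in> space M \<Longrightarrow> \<epsilon> j \<omega> \<in> {-1, 1}"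
    and "(\<exists>c. \<forall>j\<in>{1..2 * m}. \<forall>\<omega>\<in>space M. \<epsilon> j \<omega> = c j) \<or>
         prob_space.indep_pair M
           (\<Pi>\<^sub>M j\<in>{1..2 * m}. borel) (\<lambda>\<omega>. \<lambda>j\<in>{1..2 * m}. \<epsilon> j \<omega>)
           (\<Pi>\<^sub>M j\<in>{1..2 * m}. borel) (\<lambda>\<omega>. \<lambda>j\<in>{1..2 * m}. X j \<omega>)"
    and "AE \<omega> in M. (\<Sum>j=1..2 * m. \<epsilon> j \<omega>) = 0"
  shows "(\<integral>\<^sup>+\<omega>. ennreal (\<psi> (\<Sum>j=1..2 * m. \<epsilon> j \<omega> *\<^sub>R X j \<omega>)) \<partial>M)
       \<le> (\<integral>\<^sup>+\<omega>. ennreal (\<psi> (\<Sum>j=1..2 * m. X j \<omega>)) \<partial>M)"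
proof -
  interpret prob_space M by fact
  define J where "J = {1..2 * m}"
  define E where "E = (\<integral>\<^sup>+\<omega>. ennreal (\<psi> (\<Sum>j\<in>J. X j \<omega>)) \<partial>M)"
  note \<psi> = assms(3)
  note iid = assms(4)[folded J_def] and sgn = assms(5)[folded J_def]
    and cases = assms(6)[folded J_def] and bal = assms(7)[folded J_def]
  have J: "finite J" by (simp add: J_def)
  have fixed_signs: "(\<integral>\<^sup>+\<omega>'. ennreal (\<psi> (\<Sum>j\<in>J. \<epsilon> j \<omega> *\<^sub>R X j \<omega>')) \<partial>M) \<le> E"
    if "\<omega> \<in> space M" "(\<Sum>j\<in>J. \<epsilon> j \<omega>) = 0" for \<omega>
    unfolding E_def
    by (rule nn_integral_signed_sum_le[OF \<open>prob_space M\<close> \<psi> iid J]) (use sgn that in auto)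
  from cases have "(\<integral>\<^sup>+\<omega>. ennreal (\<psi> (\<Sum>j\<in>J. \<epsilon> j \<omega> *\<^sub>R X j \<omega>)) \<partial>M) \<le> E"
  proof
    assume "\<exists>c. \<forall>j\<in>J. \<forall>\<omega>\<in>space M. \<epsilon> j \<omega> = c j"
    then obtain c where c: "\<And>j \<omega>. j \<in> J \<Longrightarrow> \<omega> \<in> space M \<Longrightarrow> \<epsilon> j \<omega> = c j" by blast
    have "\<exists>\<omega>\<in>space M. (\<Sum>j\<in>J. \<epsilon> j \<omega>) = 0"
    proof (rule ccontr)
      assume no: "\<not> ?thesis"
      have "AE \<omega> in M. False"
        using bal AE_space by eventually_elim (use no in blast)
      then show False by simp
    qed
    then obtain \<omega> where \<omega>: "\<omega> \<in> space M" "(\<Sum>j\<in>J. \<epsilon> j \<omega>) = 0" by blast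
    have "(\<integral>\<^sup>+\<omega>'. ennreal (\<psi> (\<Sum>j\<in>J. \<epsilon> j \<omega>' *\<^sub>R X j \<omega>')) \<partial>M)
        = (\<integral>\<^sup>+\<omega>'. ennreal (\<psi> (\<Sum>j\<in>J. \<epsilon> j \<omega> *\<^sub>R X j \<omega>')) \<partial>M)"
      using c \<omega>(1) by (intro nn_integral_cong arg_cong[where f = "\<lambda>x. ennreal (\<psi> x)"] sum.cong) auto
    also have "\<dots> \<le> E" using \<omega> by (rule fixed_signs)
    finally show ?thesis .
  next
    assume ind: "indep_pair (\<Pi>\<^sub>M j\<in>J. borel) (\<lambda>\<omega>. \<lambda>j\<in>J. \<epsilon> j \<omega>) (\<Pi>\<^sub>M j\<in>J. borel) (\<lambda>\<omega>. \<lambda>j\<in>J. X j \<omega>)"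
    define f where "f p = ennreal (\<psi> (\<Sum>j\<in>J. fst p j *\<^sub>R snd p j))"
      for p :: "(nat \<Rightarrow> real) \<times> (nat \<Rightarrow> real ^ 'n)"
    note [measurable] = continuous_negative_definite_measurable[OF \<psi>]
    have f: "f \<in> borel_measurable ((\<Pi>\<^sub>M j\<in>J. borel) \<Otimes>\<^sub>M (\<Pi>\<^sub>M j\<in>J. borel))"
      unfolding f_def by measurable
    have f_eq: "f (\<lambda>j\<in>J. \<epsilon> j \<omega>, \<lambda>j\<in>J. X j \<omega>') = ennreal (\<psi> (\<Sum>j\<in>J. \<epsilon> j \<omega> *\<^sub>R X j \<omega>'))" for \<omega> \<omega>'
      unfolding f_def by (simp cong: sum.cong)
    have "(\<integral>\<^sup>+\<omega>. ennreal (\<psi> (\<Sum>j\<in>J. \<epsilon> j \<omega> *\<^sub>R X j \<omega>)) \<partial>M)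
        = (\<integral>\<^sup>+\<omega>. \<integral>\<^sup>+\<omega>'. ennreal (\<psi> (\<Sum>j\<in>J. \<epsilon> j \<omega> *\<^sub>R X j \<omega>')) \<partial>M \<partial>M)"
      using nn_integral_pair_indep[OF \<open>prob_space M\<close> ind f] unfolding f_eq .
    also have "\<dots> \<le> (\<integral>\<^sup>+\<omega>. E \<partial>M)"
      using bal AE_space by (intro nn_integral_mono_AE) (auto elim!: eventually_elim2 intro: fixed_signs)
    also have "\<dots> = E" by (simp add: emeasure_space_1)
    finally show ?thesis .
  qed
  then show ?thesis unfolding E_def J_def .
qed

end
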